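(* Let $n\ge 1$, let $H\in\mathbb{R}^{n\times n}$ be symmetric, $c\in\mathbb{R}^n$, $\sigma>0$ and $p>2$, and let $g(x)=\frac12 x^THx+c^Tx+\frac{\sigma}{p}\|x\|^p$ for $x\in\mathbb{R}^n$. A point $x^*\in\mathbb{R}^n$ is a global minimizer of $g$ over $\mathbb{R}^n$ if and only if it is a critical point, i.e. $\nabla g(x^* )=(H+\sigma\|x^*\|^{p-2}I)x^*+c=0$, and $H+\sigma\|x^*\|^{p-2}I\succeq 0$. Moreover, the $\ell_2$ norms of all the global minimizers of $g$ are equal.
   Context: $\|\cdot\|$ is the Euclidean norm, $I$ is the identity matrix of order $n$, and $P\succeq 0$ means that the symmetric matrix $P$ is positive semidefinite. The problem $\min_{x\in\mathbb{R}^n} g(x)$ is called the $p$-regularized subproblem (p-RS). *)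

theory Defs
  imports "HOL-Analysis.Analysis"
begin

definition pos_semidef :: "real^'n^'n \<Rightarrow> bool" where
  "pos_semidef P \<longleftrightarrow> transpose P = P \<and> (\<forall>v. 0 \<le> v \<bullet> (P *v v))"

(* For p > 2 the exponents p and p - 2 are positive, so "0 powr a = 0" agrees with the
   usual real power at x = 0. *)
definition prs_obj ::
    "real^'n^'n \<Rightarrow> real^'n \<Rightarrow> real \<Rightarrow> real \<Rightarrow> real^'n \<Rightarrow> real" where
  "prs_obj H c \<sigma> p x = (1/2) * (x \<bullet> (H *v x)) + c \<bullet> x + (\<sigma>/p) * norm x powr p"

definition prs_mat ::
    "real^'n^'n \<Rightarrow> real \<Rightarrow> real \<Rightarrow> real^'n \<Rightarrow> real^'n^'n" where
  "prs_mat H \<sigma> p x = H + (\<sigma> * norm x powr (p - 2)) *\<^sub>R mat 1"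

definition critical_point :: "(real^'n \<Rightarrow> real) \<Rightarrow> real^'n \<Rightarrow> bool" where
  "critical_point f x \<longleftrightarrow> GDERIV f x :> 0"

definition global_minimizer :: "(real^'n \<Rightarrow> real) \<Rightarrow> real^'n \<Rightarrow> bool" where
  "global_minimizer f x \<longleftrightarrow> (\<forall>y. f x \<le> f y)"

end

theory Submission
  imports Defs
begin

text \<open>At a critical point \<open>x\<close> with shifted matrix \<open>A = H + \<sigma> \<parallel>x\<parallel>\<^sup>p\<^sup>-\<^sup>2 I\<close>, the increment \<open>g y - g x\<close> equals
  half the quadratic form of \<open>A\<close> at \<open>y - x\<close> plus \<open>\<sigma>\<close> times \<open>\<phi> \<parallel>y\<parallel> - \<phi> \<parallel>x\<parallel>\<close>, where
  \<open>\<phi> r = r\<^sup>p / p - \<parallel>x\<parallel>\<^sup>p\<^sup>-\<^sup>2 r\<^sup>2 / 2\<close> has its unique minimum over \<open>r \<ge> 0\<close> at \<open>r = \<parallel>x\<parallel>\<close>. If \<open>A\<close> is positive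
  semidefinite, then \<open>x\<close> is a global minimizer and no point of a different norm is one. Conversely, at
  a minimizer the quadratic form is nonnegative at \<open>y - x\<close> for all \<open>y\<close> on the sphere through \<open>x\<close>;
  if \<open>x \<noteq> 0\<close>, these differences cover every direction not orthogonal to \<open>x\<close> and the rest
  follows by continuity, while for \<open>x = 0\<close> one lets \<open>t\<close> tend to \<open>0\<close> in \<open>g (t v) - g 0 \<ge> 0\<close>.\<close>

text \<open>The chain rule through \<open>norm\<close> works only away from \<open>0\<close>. At
  \<open>0\<close> the difference quotient is \<open>norm y powr (p - 1)\<close>, which tends to
  \<open>0\<close> because \<open>1 < p\<close>.\<close>

lemma GDERIV_norm_powr:
  fixes x :: "'a::real_inner"
  assumes "1 < p"
  shows "GDERIV (\<lambda>x. norm x powr p) x :> (p * norm x powr (p - 2)) *\<^sub>R x"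
proof (cases "x = 0")
  case True
  have "((\<lambda>y::'a. norm y powr p) has_derivative (\<lambda>h. 0)) (at 0)"
  proof (rule has_derivativeI_sandwich[where e = 1 and H = "\<lambda>y. norm y powr (p - 1)"])
    have "((\<lambda>y::'a. norm y powr (p - 1)) \<longlongrightarrow> norm (0::'a) powr (p - 1)) (at 0)"
      using assms by (intro tendsto_powr' tendsto_norm tendsto_ident_at tendsto_const) auto
    then show "((\<lambda>y::'a. norm y powr (p - 1)) \<longlongrightarrow> 0) (at 0)"
      by simp
  qed (auto simp: powr_diff)
  with True show ?thesis
    by (simp add: gderiv_def)
next
  case False
  have "((\<lambda>z. z powr p) has_real_derivative p * norm x powr (p - 1)) (at (norm x))"
    using False by (intro has_real_derivative_powr) auto
  from GDERIV_DERIV_compose[OF GDERIV_norm[OF False] this]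
  show ?thesis
  proof (rule GDERIV_subst)
    have "norm x powr (p - 1) = norm x powr (p - 2) * norm x"
      using False powr_mult_base[of "norm x" "p - 2"] by (simp add: mult.commute)
    with False show "(p * norm x powr (p - 1)) *\<^sub>R sgn x = (p * norm x powr (p - 2)) *\<^sub>R x"
      by (simp add: sgn_div_norm)
  qed
qed

lemma GDERIV_global_min_zero:
  assumes "GDERIV f x :> D" and "\<And>y. f x \<le> f y"
  shows "D = 0"
proof -
  have "(\<lambda>h. h \<bullet> D) = (\<lambda>h. 0)"
    using assms by (intro has_derivative_local_min[of f _ x]) (auto simp: gderiv_def)
  then have "D \<bullet> D = 0"
    by meson
  then show ?thesis
    by simp
qed

lemma GDERIV_quadratic_form:
  fixes H :: "real^'n^'n"
  assumes "transpose H = H"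
  shows "GDERIV (\<lambda>x. x \<bullet> (H *v x)) x :> 2 *\<^sub>R (H *v x)"
proof -
  have "((\<lambda>x. x \<bullet> (H *v x)) has_derivative (\<lambda>h. x \<bullet> (H *v h) + h \<bullet> (H *v x))) (at x)"
    by (intro has_derivative_inner has_derivative_ident
        bounded_linear.has_derivative[OF matrix_vector_mul_bounded_linear])
  moreover have "x \<bullet> (H *v h) = h \<bullet> (H *v x)" for h
    using assms by (metis dot_lmul_matrix inner_commute vector_transpose_matrix)
  ultimately show ?thesis
    by (simp add: gderiv_def)
qed

text \<open>The derivative \<open>z * (z powr (p - 2) - a powr (p - 2))\<close> of the left-hand side changes sign from
  negative to positive at \<open>a\<close>.\<close>
lemma powr_quadratic_strict_min:
  fixes a r p :: real
  assumes "0 \<le> a" "0 \<le> r" "r \<noteq> a" "2 < p"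
  shows "a powr p / p - a powr (p - 2) / 2 * a\<^sup>2 < r powr p / p - a powr (p - 2) / 2 * r\<^sup>2"
proof -
  define f where "f z = z powr p / p - a powr (p - 2) / 2 * z\<^sup>2" for z
  have deriv: "(f has_real_derivative z * (z powr (p - 2) - a powr (p - 2))) (at z)" if "0 < z" for z
  proof -
    have "z powr (p - 1) = z * z powr (p - 2)"
      using that powr_mult_base[of z "p - 2"] by simp
    with that assms show ?thesis
      unfolding f_def by (auto intro!: derivative_eq_intros simp: field_simps)
  qed
  \<comment> \<open>The interval may start at \<open>0\<close>, where \<open>deriv\<close> says
    nothing; the mean value theorem needs only continuity there.\<close>
  have cont: "continuous_on {u..v} f" if "0 \<le> u" for u v
    unfolding f_def using that assms by (intro continuous_intros continuous_on_powr') auto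
  have mvt: "\<exists>z. u < z \<and> z < v \<and> f v - f u = (v - u) * (z * (z powr (p - 2) - a powr (p - 2)))"
    if "0 \<le> u" "u < v" for u v
  proof -
    have "f differentiable (at z)" if "u < z" for z
      using deriv[of z] that \<open>0 \<le> u\<close> real_differentiable_def by auto
    then obtain l z where z: "u < z" "z < v" "DERIV f z :> l" "f v - f u = (v - u) * l"
      using MVT[OF \<open>u < v\<close> cont[OF \<open>0 \<le> u\<close>]] by blast
    moreover have "l = z * (z powr (p - 2) - a powr (p - 2))"
      using DERIV_unique[OF z(3) deriv] z(1) \<open>0 \<le> u\<close> by simp
    ultimately show ?thesis by blast
  qed
  have "f a < f r"
  proof (cases "a < r")
    case True
    then obtain z where z: "a < z" "f r - f a = (r - a) * (z * (z powr (p - 2) - a powr (p - 2)))"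
      using mvt assms by blast
    moreover have "a powr (p - 2) < z powr (p - 2)"
      using z assms by (intro powr_less_mono2) auto
    ultimately have "0 < f r - f a"
      using True assms by simp
    then show ?thesis by simp
  next
    case False
    then obtain z where z: "r < z" "z < a" "f a - f r = (a - r) * (z * (z powr (p - 2) - a powr (p - 2)))"
      using mvt[of r a] assms by auto
    moreover have "z powr (p - 2) < a powr (p - 2)"
      using z assms by (intro powr_less_mono2) auto
    ultimately have "f a - f r < 0"
      using False assms by (simp add: mult_pos_neg)
    then show ?thesis by simp
  qed
  then show ?thesis
    by (simp add: f_def)
qed

lemma prs_mat_mult_vec:
  "prs_mat H \<sigma> p x *v v = H *v v + (\<sigma> * norm x powr (p - 2)) *\<^sub>R v"
  by (simp add: prs_mat_def matrix_vector_mult_add_rdistrib flip: scaleR_matrix_vector_assoc)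

lemma transpose_prs_mat:
  assumes "transpose H = H"
  shows "transpose (prs_mat H \<sigma> p x) = prs_mat H \<sigma> p x"
  using assms by (auto simp: prs_mat_def transpose_def vec_eq_iff mat_def)

lemma GDERIV_prs_obj:
  assumes "transpose H = H" "2 < p"
  shows "GDERIV (prs_obj H c \<sigma> p) x :> prs_mat H \<sigma> p x *v x + c"
proof -
  have "((\<lambda>x. (1/2) * (x \<bullet> (H *v x)) + c \<bullet> x + (\<sigma>/p) * norm x powr p) has_derivative
      (\<lambda>h. (1/2) * (h \<bullet> (2 *\<^sub>R (H *v x))) + c \<bullet> h
        + (\<sigma>/p) * (h \<bullet> ((p * norm x powr (p - 2)) *\<^sub>R x)))) (at x)"
    using GDERIV_quadratic_form[OF assms(1), of x] GDERIV_norm_powr[of p x] assms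
    unfolding gderiv_def
    by (intro has_derivative_add has_derivative_mult_right has_derivative_inner_right
        has_derivative_ident) auto
  then show ?thesis
    using assms unfolding gderiv_def prs_obj_def
    by (simp add: prs_mat_mult_vec inner_add_right inner_commute field_simps)
qed

text \<open>Substituting the critical equation for \<open>c\<close> completes the square of the
  \<open>H\<close> part around \<open>x\<close>. The remaining linear term
  \<open>- s * ((y - x) \<bullet> x)\<close>, where \<open>s\<close> is the shift, equals
  \<open>s / 2\<close> times the squared distance of \<open>y\<close> and \<open>x\<close>, minus
  \<open>s / 2\<close> times the difference of their squared norms.\<close>

lemma prs_obj_increment:
  assumes "transpose H = H" "prs_mat H \<sigma> p x *v x + c = 0"
  shows "prs_obj H c \<sigma> p y - prs_obj H c \<sigma> p x =
    (1/2) * ((y - x) \<bullet> (prs_mat H \<sigma> p x *v (y - x)))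
    + \<sigma> * ((norm y powr p / p - norm x powr (p - 2) / 2 * (norm y)\<^sup>2)
         - (norm x powr p / p - norm x powr (p - 2) / 2 * (norm x)\<^sup>2))"
proof -
  define s where "s = \<sigma> * norm x powr (p - 2)"
  have c: "c = - (H *v x + s *\<^sub>R x)"
    using assms(2) unfolding prs_mat_mult_vec s_def[symmetric] by (metis add.commute eq_neg_iff_add_eq_0)
  have sym: "x \<bullet> (H *v y) = y \<bullet> (H *v x)"
    using assms by (metis dot_lmul_matrix inner_commute vector_transpose_matrix)
  have lin: "c \<bullet> z = - (z \<bullet> (H *v x)) - s * (z \<bullet> x)" for z
    unfolding c by (simp add: inner_diff_right inner_commute[of _ z])
  have quad: "(y - x) \<bullet> (prs_mat H \<sigma> p x *v (y - x)) =
      y \<bullet> (H *v y) - 2 * (y \<bullet> (H *v x)) + x \<bullet> (H *v x)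
      + s * ((norm y)\<^sup>2 - 2 * (y \<bullet> x) + (norm x)\<^sup>2)"
    unfolding prs_mat_mult_vec s_def[symmetric] power2_norm_eq_inner
    by (simp add: matrix_vector_mult_diff_distrib inner_add_right inner_diff_left inner_diff_right
        sym inner_commute[of x y] algebra_simps)
  have gap: "\<sigma> * ((norm y powr p / p - norm x powr (p - 2) / 2 * (norm y)\<^sup>2)
         - (norm x powr p / p - norm x powr (p - 2) / 2 * (norm x)\<^sup>2))
      = \<sigma> / p * norm y powr p - \<sigma> / p * norm x powr p - s / 2 * (norm y)\<^sup>2 + s / 2 * (norm x)\<^sup>2"
    by (simp add: s_def algebra_simps)
  show ?thesis
    unfolding quad gap prs_obj_def lin by (simp add: power2_norm_eq_inner algebra_simps)
qed

text \<open>Strictness comes from the radial term alone, so the shifted matrix may be singular. This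
  is what forces all minimizers to have the same norm.\<close>

lemma prs_obj_less:
  assumes "transpose H = H" "0 < \<sigma>" "2 < p" "prs_mat H \<sigma> p x *v x + c = 0"
    and "pos_semidef (prs_mat H \<sigma> p x)" "norm y \<noteq> norm x"
  shows "prs_obj H c \<sigma> p x < prs_obj H c \<sigma> p y"
proof -
  have "0 \<le> (y - x) \<bullet> (prs_mat H \<sigma> p x *v (y - x))"
    using assms by (auto simp: pos_semidef_def)
  moreover have "0 < \<sigma> * ((norm y powr p / p - norm x powr (p - 2) / 2 * (norm y)\<^sup>2)
         - (norm x powr p / p - norm x powr (p - 2) / 2 * (norm x)\<^sup>2))"
    using powr_quadratic_strict_min[of "norm x" "norm y" p] assms by simp
  ultimately show ?thesis
    using prs_obj_increment[OF assms(1,4), of y] by linarith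
qed

lemma prs_obj_le:
  assumes "transpose H = H" "0 < \<sigma>" "2 < p" "prs_mat H \<sigma> p x *v x + c = 0"
    and "pos_semidef (prs_mat H \<sigma> p x)"
  shows "prs_obj H c \<sigma> p x \<le> prs_obj H c \<sigma> p y"
proof (cases "norm y = norm x")
  case True
  then show ?thesis
    using prs_obj_increment[OF assms(1,4), of y]
      assms(5)[unfolded pos_semidef_def, THEN conjunct2, rule_format, of "y - x"]
    by simp
next
  case False
  then show ?thesis
    using prs_obj_less[OF assms] less_imp_le by blast
qed

lemma quadratic_form_nonneg_if_sphere_min:
  fixes A :: "real^'n^'n"
  assumes sphere: "\<And>y. norm y = norm x \<Longrightarrow> 0 \<le> (y - x) \<bullet> (A *v (y - x))" and "x \<noteq> 0"
  shows "0 \<le> v \<bullet> (A *v v)"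
proof -
  \<comment> \<open>\<open>x + k *\<^sub>R w\<close> is the reflection of \<open>x\<close> in the hyperplane orthogonal to \<open>w\<close>.\<close>
  have non_orth: "0 \<le> w \<bullet> (A *v w)" if "w \<bullet> x \<noteq> 0" for w
  proof -
    define k where "k = - 2 * (w \<bullet> x) / (w \<bullet> w)"
    have "w \<bullet> w \<noteq> 0" using that by auto
    then have k: "k \<noteq> 0" "k * (w \<bullet> w) = - 2 * (w \<bullet> x)"
      using that by (auto simp: k_def)
    have "(x + k *\<^sub>R w) \<bullet> (x + k *\<^sub>R w) = x \<bullet> x + k * (2 * (w \<bullet> x) + k * (w \<bullet> w))"
      by (simp add: inner_simps inner_commute algebra_simps)
    with k have "norm (x + k *\<^sub>R w) = norm x"
      by (simp add: norm_eq)
    from sphere[OF this] have "0 \<le> k\<^sup>2 * (w \<bullet> (A *v w))"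
      by (simp add: matrix_vector_mult_scaleR power2_eq_square mult.assoc)
    with k show ?thesis
      by (simp add: zero_le_mult_iff)
  qed
  show ?thesis
  proof (cases "v \<bullet> x = 0")
    case True
    \<comment> \<open>Tilting \<open>v\<close> towards \<open>x\<close> leaves the orthogonal
      complement: the inner product with \<open>x\<close> becomes
      \<open>t * (x \<bullet> x)\<close>, nonzero for \<open>t \<noteq> 0\<close>.\<close>
    let ?q = "\<lambda>t. (v + t *\<^sub>R x) \<bullet> (A *v (v + t *\<^sub>R x))"
    have "(?q \<longlongrightarrow> ?q 0) (at 0)"
      by (intro tendsto_intros bounded_linear.tendsto[OF matrix_vector_mul_bounded_linear])
    moreover have "\<forall>\<^sub>F t in at 0. 0 \<le> ?q t"
    proof -
      have "(v + t *\<^sub>R x) \<bullet> x \<noteq> 0" if "t \<noteq> 0" for t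
        using True \<open>x \<noteq> 0\<close> that by (simp add: inner_add_left)
      then show ?thesis
        by (auto simp only: eventually_at_filter intro!: always_eventually non_orth)
    qed
    ultimately have "0 \<le> ?q 0"
      by (intro tendsto_lowerbound[of ?q "?q 0" "at 0"]) auto
    then show ?thesis by simp
  qed (rule non_orth)
qed

lemma pos_semidef_prs_mat_if_minimizer:
  assumes "transpose H = H" "0 < \<sigma>" "2 < p" "prs_mat H \<sigma> p x *v x + c = 0"
    and min: "\<And>y. prs_obj H c \<sigma> p x \<le> prs_obj H c \<sigma> p y"
  shows "pos_semidef (prs_mat H \<sigma> p x)"
proof -
  note incr = prs_obj_increment[OF assms(1,4)]
  have "0 \<le> v \<bullet> (prs_mat H \<sigma> p x *v v)" for v
  proof (cases "x = 0")
    case True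
    let ?Q = "v \<bullet> (prs_mat H \<sigma> p x *v v)"
    \<comment> \<open>For \<open>t > 0\<close> this is the increment from \<open>0\<close> to
      \<open>t *\<^sub>R v\<close> divided by the square of \<open>t\<close>; the shift vanishes at
      \<open>x = 0\<close>. Its last term tends to \<open>0\<close> because
      \<open>2 < p\<close>.\<close>
    let ?h = "\<lambda>t. ?Q / 2 + \<sigma> / p * norm v powr p * t powr (p - 2)"
    have "(?h \<longlongrightarrow> ?Q / 2 + \<sigma> / p * norm v powr p * 0 powr (p - 2)) (at_right 0)"
      using assms by (intro tendsto_intros tendsto_powr') (auto simp: eventually_at_filter)
    moreover have "0 \<le> ?h t" if "0 < t" for t
    proof -
      have "t powr p = t\<^sup>2 * t powr (p - 2)"
        using that by (simp add: powr_diff)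
      then have "prs_obj H c \<sigma> p (t *\<^sub>R v) - prs_obj H c \<sigma> p x = t\<^sup>2 * ?h t"
        unfolding incr using True that assms
        by (simp add: matrix_vector_mult_scaleR powr_mult power2_eq_square field_simps)
      then have "0 \<le> t\<^sup>2 * ?h t"
        using min[of "t *\<^sub>R v"] by linarith
      with that show ?thesis
        by (simp add: zero_le_mult_iff)
    qed
    then have "\<forall>\<^sub>F t in at_right 0. 0 \<le> ?h t"
      by (auto simp: eventually_at_filter)
    ultimately have "0 \<le> ?Q / 2 + \<sigma> / p * norm v powr p * 0 powr (p - 2)"
      by (rule tendsto_lowerbound) simp
    then show ?thesis by simp
  next
    case False
    show ?thesis
    proof (rule quadratic_form_nonneg_if_sphere_min[OF _ False])
      \<comment> \<open>On the sphere the radial terms cancel, so the increment is exactly half the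
        quadratic form.\<close>
      fix y :: "real^'a" assume "norm y = norm x"
      then show "0 \<le> (y - x) \<bullet> (prs_mat H \<sigma> p x *v (y - x))"
        using incr[of y] min[of y] by simp
    qed
  qed
  then show ?thesis
    using transpose_prs_mat[OF assms(1)] by (simp add: pos_semidef_def)
qed

theorem theorem1:
  fixes H :: "real^'n^'n" and c :: "real^'n" and \<sigma> p :: real
  assumes "transpose H = H" and "\<sigma> > 0" and "p > 2"
  defines "g \<equiv> prs_obj H c \<sigma> p"
  shows "(\<forall>x. GDERIV g x :> prs_mat H \<sigma> p x *v x + c) \<and>
         (\<forall>xs. global_minimizer g xs \<longleftrightarrow>
            critical_point g xs \<and> pos_semidef (prs_mat H \<sigma> p xs)) \<and>
         (\<forall>x y. global_minimizer g x \<and> global_minimizer g y \<longrightarrow> norm x = norm y)"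
proof -
  have grad: "GDERIV g x :> prs_mat H \<sigma> p x *v x + c" for x
    unfolding g_def using assms(1,3) by (rule GDERIV_prs_obj)
  \<comment> \<open>Uniqueness of the derivative turns a vanishing gradient into the algebraic
    equation that the increment formula uses.\<close>
  have crit: "critical_point g x \<longleftrightarrow> prs_mat H \<sigma> p x *v x + c = 0" for x
  proof
    assume "critical_point g x"
    then have "GDERIV g x :> 0"
      by (simp add: critical_point_def)
    with grad[of x] have "(\<lambda>h. h \<bullet> (prs_mat H \<sigma> p x *v x + c)) = (\<lambda>h. h \<bullet> 0)"
      unfolding gderiv_def by (rule has_derivative_unique)
    then show "prs_mat H \<sigma> p x *v x + c = 0"
      by (metis inner_eq_zero_iff inner_zero_right)
  qed (use grad[of x] in \<open>simp add: critical_point_def\<close>)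
  have necessary: "critical_point g x \<and> pos_semidef (prs_mat H \<sigma> p x)"
    if "global_minimizer g x" for x
  proof -
    have "prs_mat H \<sigma> p x *v x + c = 0"
      using that GDERIV_global_min_zero[OF grad] by (auto simp: global_minimizer_def)
    with that assms(1-3) show ?thesis
      unfolding crit by (auto simp: g_def global_minimizer_def intro: pos_semidef_prs_mat_if_minimizer)
  qed
  have sufficient: "global_minimizer g x"
    if "critical_point g x" "pos_semidef (prs_mat H \<sigma> p x)" for x
    using prs_obj_le[OF assms(1-3)] that unfolding crit unfolding g_def global_minimizer_def by blast
  have "norm x = norm y" if "global_minimizer g x" "global_minimizer g y" for x y
  proof (rule ccontr)
    assume "norm x \<noteq> norm y"
    \<comment> \<open>The necessary conditions at \<open>x\<close> alone suffice; the strict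
      inequality contradicts minimality of \<open>y\<close>.\<close>
    then have "g x < g y"
      using necessary[OF that(1)] assms(1-3) unfolding crit unfolding g_def by (intro prs_obj_less) auto
    with that show False
      by (auto simp: global_minimizer_def dest: leD)
  qed
  with grad necessary sufficient show ?thesis by blast
qed

end
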